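(* Let $m$ be a positive integer and let \[ S_{2m+1}(x)=\sum_{s=0}^m x^{2s+1}\left(\sum_{k=s}^m \frac{1+2k}{1+2s}\binom{2m+1}{m-k}\binom{k+s}{2s}\frac{(-5)^{s-m}}{L_{2k+1}}\right)-\sum_{k=0}^m (-1)^{m-k}\binom{2m+1}{m-k}\frac{F_{2k+1}}{L_{2k+1}}5^{-m}. \] Then $(x-1)^2$ divides $S_{2m+1}(x)$; that is, $S_{2m+1}(1)=0$ and $S_{2m+1}'(1)=0$.
   Context: $F_n$ and $L_n$ are the Fibonacci and Lucas numbers: $F_0=0$, $F_1=1$, $L_0=2$, $L_1=1$, and both satisfy $a_n=a_{n-1}+a_{n-2}$. *)

theory Defs
  imports "HOL-Number_Theory.Fib" "HOL-Computational_Algebra.Polynomial"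
begin

fun lucas :: "nat \<Rightarrow> nat" where
  "lucas 0 = 2"
| "lucas (Suc 0) = 1"
| "lucas (Suc (Suc n)) = lucas (Suc n) + lucas n"

text \<open>The argument is \<open>m\<close>, so \<open>S_poly m\<close> is the polynomial $S_{2m+1}$, with rational
  coefficients.\<close>

definition S_poly :: "nat \<Rightarrow> rat poly" where
  "S_poly m =
     (\<Sum>s=0..m. monom
        (\<Sum>k=s..m. (of_nat (1 + 2 * k) / of_nat (1 + 2 * s))
           * of_nat ((2 * m + 1) choose (m - k)) * of_nat ((k + s) choose (2 * s))
           * ((-5) powi (int s - int m) / of_nat (lucas (2 * k + 1))))
        (2 * s + 1))
     - [:\<Sum>k=0..m. (-1) ^ (m - k) * of_nat ((2 * m + 1) choose (m - k))
           * (of_nat (fib (2 * k + 1)) / of_nat (lucas (2 * k + 1)))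
           * 5 powi (- int m):]"

end

theory Submission
  imports Defs
begin

text \<open>
  Since $\frac{1+2k}{1+2s}\binom{k+s}{2s} = \binom{k+s}{2s} + 2\binom{k+s}{2s+1}$, the inner sums over
  $s$ at $x = 1$ reduce to $A_k = \sum_s \binom{k+s}{2s}(-5)^s$ and
  $B_k = \sum_s \binom{k+s}{2s+1}(-5)^s$. Pascal's rule gives $B_{k+1} = B_k + A_k$ and
  $A_{k+1} = A_k - 5 B_{k+1}$, hence $A_k = (-1)^k L_{2k+1}$ and $B_k = -(-1)^k F_{2k}$.
  So $A_k + 2 B_k = (-1)^k F_{2k+1}$, which makes the two parts of $S_{2m+1}(1)$ cancel, while in
  $S_{2m+1}'(1)$ the factors $L_{2k+1}$ cancel and leave a multiple of
  $\sum_k (-1)^k (2k+1) \binom{2m+1}{m-k}$, which vanishes for $m \ge 1$.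
\<close>

lemma lucas_eq_fib: "lucas (Suc n) = fib (Suc (Suc n)) + fib n"
  by (induction n rule: fib.induct) auto

text \<open>The source of the constant 5: it makes -5 the argument at which the Pascal recurrences
  below close up within Lucas and Fibonacci numbers.\<close>

lemma lucas_add_lucas: "lucas (Suc (Suc n)) + lucas n = 5 * fib (Suc n)"
  by (induction n rule: fib.induct) auto

lemma lucas_pos: "lucas n > 0"
  by (induction n rule: lucas.induct) auto

text \<open>Split off the term \<open>s = 0\<close>, shift the index and apply Pascal's rule. One
  half, with the 1 put back, is the even sum for \<open>k\<close>; the other is \<open>z\<close>
  times the new odd sum. The extra top terms vanish because the lower index exceeds the upper
  one.\<close>

lemma sum_choose_even_Suc:
  fixes z :: "'a::comm_ring_1"
  shows "(\<Sum>s\<le>Suc k. of_nat ((Suc k + s) choose (2 * s)) * z ^ s) =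
    (\<Sum>s\<le>k. of_nat ((k + s) choose (2 * s)) * z ^ s)
      + z * (\<Sum>s\<le>Suc k. of_nat ((Suc k + s) choose (2 * s + 1)) * z ^ s)"
proof -
  have "(\<Sum>s\<le>Suc k. of_nat ((Suc k + s) choose (2 * s)) * z ^ s)
      = 1 + (\<Sum>s\<le>k. of_nat ((Suc (Suc (k + s))) choose (Suc (Suc (2 * s)))) * z ^ Suc s)"
    by (subst sum.atMost_Suc_shift) simp
  also have "\<dots> = (1 + (\<Sum>s\<le>k. of_nat ((Suc (k + s)) choose (Suc (Suc (2 * s)))) * z ^ Suc s))
      + z * (\<Sum>s\<le>k. of_nat ((Suc (k + s)) choose (Suc (2 * s))) * z ^ s)"
    by (simp add: sum_distrib_left sum.distrib algebra_simps)
  also have "1 + (\<Sum>s\<le>k. of_nat ((Suc (k + s)) choose (Suc (Suc (2 * s)))) * z ^ Suc s)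
      = (\<Sum>s\<le>Suc k. of_nat ((k + s) choose (2 * s)) * z ^ s)"
    by (subst sum.atMost_Suc_shift) simp
  finally show ?thesis
    by (simp add: binomial_eq_0)
qed

lemma sum_choose_odd_Suc:
  fixes z :: "'a::comm_ring_1"
  shows "(\<Sum>s\<le>Suc k. of_nat ((Suc k + s) choose (2 * s + 1)) * z ^ s) =
    (\<Sum>s\<le>k. of_nat ((k + s) choose (2 * s + 1)) * z ^ s)
      + (\<Sum>s\<le>k. of_nat ((k + s) choose (2 * s)) * z ^ s)"
  by (simp add: sum.distrib algebra_simps binomial_eq_0)

text \<open>Both closed forms are proved in one induction because each recurrence involves the other
  sum. The odd sum comes first, since the even recurrence uses its value at
  \<open>Suc k\<close>.\<close>

lemma sum_choose_lucas_fib: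
  "(\<Sum>s\<le>k. of_nat ((k + s) choose (2 * s)) * (-5) ^ s) =
     (-1) ^ k * (of_nat (lucas (2 * k + 1)) :: 'a::comm_ring_1) \<and>
   (\<Sum>s\<le>k. of_nat ((k + s) choose (2 * s + 1)) * (-5) ^ s) =
     - ((-1) ^ k * (of_nat (fib (2 * k)) :: 'a))"
proof (induction k)
  case 0
  show ?case by simp
next
  case (Suc k)
  have odd: "(\<Sum>s\<le>Suc k. of_nat ((Suc k + s) choose (2 * s + 1)) * (-5) ^ s) =
      - ((-1) ^ Suc k * (of_nat (fib (2 * Suc k)) :: 'a))"
    unfolding sum_choose_odd_Suc using Suc.IH lucas_eq_fib[of "2 * k"]
    by (simp add: algebra_simps)
  have "of_nat (lucas (2 * k + 3)) + of_nat (lucas (2 * k + 1)) =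
      5 * (of_nat (fib (2 * k + 2)) :: 'a)"
    using arg_cong[OF lucas_add_lucas[of "2 * k + 1"], of "of_nat :: nat \<Rightarrow> 'a"]
    by (simp add: numeral_3_eq_3 del: fib.simps lucas.simps)
  then have luc: "of_nat (lucas (2 * Suc k + 1)) =
      5 * (of_nat (fib (2 * Suc k)) :: 'a) - of_nat (lucas (2 * k + 1))"
    by (simp add: eq_diff_eq numeral_3_eq_3 del: fib.simps lucas.simps)
  have "(\<Sum>s\<le>Suc k. of_nat ((Suc k + s) choose (2 * s)) * (-5) ^ s) =
      (-1) ^ Suc k * (of_nat (lucas (2 * Suc k + 1)) :: 'a)"
    unfolding sum_choose_even_Suc odd luc using Suc.IH
    by (simp add: algebra_simps del: fib.simps lucas.simps)
  with odd show ?case by blast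
qed

text \<open>Write 1 + 2k = (1 + 2s) + 2(k - s) and absorb the factor k - s into the binomial
  coefficient; this removes the denominator.\<close>

lemma ratio_choose_eq:
  assumes "s \<le> k"
  shows "of_nat (1 + 2 * k) / of_nat (1 + 2 * s) * of_nat ((k + s) choose (2 * s)) =
    (of_nat ((k + s) choose (2 * s)) + 2 * of_nat ((k + s) choose (2 * s + 1)) :: 'a::field_char_0)"
proof -
  have "(of_nat (1 + 2 * s) :: 'a) \<noteq> 0"
    unfolding of_nat_eq_0_iff by simp
  \<comment> \<open>By the two absorption laws, both sides equal
    \<open>(k + s) * ((k + s - 1) choose (2 * s))\<close>.\<close>
  have "(2 * s + 1) * ((k + s) choose (2 * s + 1)) = (k - s) * ((k + s) choose (2 * s))"
    using binomial_absorb_comp[of "k + s" "2 * s"] binomial_absorption[of "2 * s" "k + s"] assms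
    by simp
  then have absorb: "of_nat (2 * s + 1) * of_nat ((k + s) choose (2 * s + 1)) =
      (of_nat k - of_nat s) * (of_nat ((k + s) choose (2 * s)) :: 'a)"
    using assms by (metis of_nat_diff of_nat_mult)
  have "of_nat (1 + 2 * k) * of_nat ((k + s) choose (2 * s)) =
      of_nat (2 * s + 1) * of_nat ((k + s) choose (2 * s))
        + 2 * ((of_nat k - of_nat s) * (of_nat ((k + s) choose (2 * s)) :: 'a))"
    by (simp add: algebra_simps)
  then have "of_nat (1 + 2 * k) * of_nat ((k + s) choose (2 * s)) =
      of_nat (1 + 2 * s) *
        (of_nat ((k + s) choose (2 * s)) + 2 * of_nat ((k + s) choose (2 * s + 1)) :: 'a)"
    unfolding absorb[symmetric] by (simp only: distrib_left mult.left_commute add.commute)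
  with \<open>of_nat (1 + 2 * s) \<noteq> 0\<close> show ?thesis
    by (simp add: divide_eq_eq mult.commute del: of_nat_add of_nat_mult of_nat_Suc)
qed

lemma sum_ratio_choose_fib:
  "(\<Sum>s\<le>k. of_nat (1 + 2 * k) / of_nat (1 + 2 * s) * of_nat ((k + s) choose (2 * s)) * (-5) ^ s) =
     (-1) ^ k * (of_nat (fib (2 * k + 1)) :: 'a::field_char_0)"
proof -
  have "(\<Sum>s\<le>k. of_nat (1 + 2 * k) / of_nat (1 + 2 * s) * of_nat ((k + s) choose (2 * s)) * (-5) ^ s)
      = (\<Sum>s\<le>k. (of_nat ((k + s) choose (2 * s)) + 2 * of_nat ((k + s) choose (2 * s + 1)))
          * (-5 :: 'a) ^ s)"
    by (intro sum.cong refl arg_cong2[where f = "(*)"] ratio_choose_eq) simp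
  also have "\<dots> = (\<Sum>s\<le>k. of_nat ((k + s) choose (2 * s)) * (-5) ^ s)
      + 2 * (\<Sum>s\<le>k. of_nat ((k + s) choose (2 * s + 1)) * (-5) ^ s)"
    by (simp only: sum.distrib sum_distrib_left distrib_right mult.assoc)
  \<comment> \<open>Here L_{2k+1} - 2 F_{2k} = F_{2k+2} - F_{2k} = F_{2k+1}.\<close>
  also have "\<dots> = (-1) ^ k * of_nat (fib (2 * k + 1))"
    unfolding conjunct1[OF sum_choose_lucas_fib] conjunct2[OF sum_choose_lucas_fib]
    using lucas_eq_fib[of "2 * k"] by (simp add: algebra_simps)
  finally show ?thesis .
qed

text \<open>Absorption followed by Pascal's rule turns (n+2-2j) C(n+2,j) into (n+2)(C(n,j) -
  C(n,j-2)), so the alternating sum telescopes to two neighbouring terms. The \<open>if\<close>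
  encodes C(n,-1) = 0, which truncated subtraction would misread as C(n,0).\<close>

lemma alternating_linear_choose_partial_sum:
  "(\<Sum>j\<le>J. (-1) ^ j * (of_nat (n + 2) - 2 * of_nat j) * of_nat ((n + 2) choose j)) =
     (-1) ^ J * of_nat (n + 2) *
       (of_nat (n choose J) - (if J = 0 then 0 else of_nat (n choose (J - 1))) :: 'a::comm_ring_1)"
proof (induction J)
  case 0
  show ?case by simp
next
  case (Suc J)
  have "Suc J * ((n + 2) choose Suc J) = (n + 2) * (Suc n choose J)"
    using binomial_absorption[of J "n + 2"] by simp
  then have absorb: "of_nat (Suc J) * of_nat ((n + 2) choose Suc J) =
      (of_nat (n + 2) * of_nat (Suc n choose J) :: 'a)"
    by (metis of_nat_mult)
  have pascal: "((n + 2) choose Suc J) = (Suc n choose J) + (Suc n choose Suc J)"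
    by simp
  have "(of_nat (n + 2) - 2 * of_nat (Suc J)) * of_nat ((n + 2) choose Suc J) =
      of_nat (n + 2) * of_nat ((n + 2) choose Suc J)
        - 2 * (of_nat (Suc J) * (of_nat ((n + 2) choose Suc J) :: 'a))"
    by (simp only: left_diff_distrib mult.assoc)
  also have "\<dots> = of_nat (n + 2) * (of_nat (Suc n choose Suc J) - of_nat (Suc n choose J))"
    unfolding absorb unfolding pascal by (simp only: of_nat_add) (simp add: algebra_simps)
  finally have *: "(of_nat (n + 2) - 2 * of_nat (Suc J)) * of_nat ((n + 2) choose Suc J) =
      (of_nat (n + 2) * (of_nat (Suc n choose Suc J) - of_nat (Suc n choose J)) :: 'a)" .
  show ?case
    unfolding sum.atMost_Suc Suc.IH unfolding mult.assoc *
    by (cases J) (simp_all add: algebra_simps)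
qed

text \<open>Reversing the sum by j = m - k turns the weight 2k+1 into 2m+1-2j, so the telescoped
  form applies with n = 2m-1 and J = m. For m = 0 the sum would be 1.\<close>

lemma alternating_odd_choose_sum:
  assumes "m \<ge> 1"
  shows "(\<Sum>k\<le>m. (-1) ^ k * of_nat (2 * k + 1) * of_nat ((2 * m + 1) choose (m - k)))
     = (0 :: 'a::comm_ring_1)"
proof -
  have "(\<Sum>k\<le>m. (-1) ^ k * of_nat (2 * k + 1) * of_nat ((2 * m + 1) choose (m - k)))
     = (\<Sum>j\<le>m. (-1) ^ (m - j) * of_nat (2 * (m - j) + 1) * (of_nat ((2 * m + 1) choose j) :: 'a))"
    by (rule sum.reindex_bij_witness[of _ "\<lambda>j. m - j" "\<lambda>j. m - j"]) auto
  also have "\<dots> = (-1) ^ m * (\<Sum>j\<le>m. (-1) ^ j * (of_nat ((2 * m - 1) + 2) - 2 * of_nat j) *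
      of_nat (((2 * m - 1) + 2) choose j))"
    unfolding sum_distrib_left
  proof (rule sum.cong)
    fix j assume "j \<in> {..m}"
    then obtain i where m: "m = j + i"
      by (auto simp: le_iff_add)
    have eq: "2 * m - 1 + 2 = 2 * m + 1"
      using assms by simp
    show "(-1) ^ (m - j) * of_nat (2 * (m - j) + 1) * (of_nat ((2 * m + 1) choose j) :: 'a) =
        (-1) ^ m * ((-1) ^ j * (of_nat ((2 * m - 1) + 2) - 2 * of_nat j) *
          of_nat (((2 * m - 1) + 2) choose j))"
      unfolding eq by (simp add: m power_add mult_ac)
  qed simp
  also have "\<dots> = 0"
  proof -
    \<comment> \<open>The two surviving terms are the middle entries of an odd row, equal by
      symmetry.\<close>
    have "(2 * m - 1) choose m = (2 * m - 1) choose (m - 1)"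
      using binomial_symmetric[of m "2 * m - 1"] assms by simp
    then show ?thesis
      unfolding alternating_linear_choose_partial_sum using assms by simp
  qed
  finally show ?thesis .
qed

text \<open>Taking k as the outer index lets the factors depending only on k, notably 1/L_{2k+1},
  leave the sum over s.\<close>

lemma sum_triangle_swap:
  fixes f :: "nat \<Rightarrow> nat \<Rightarrow> 'a::comm_monoid_add"
  shows "(\<Sum>s=0..m. \<Sum>k=s..m. f s k) = (\<Sum>k\<le>m. \<Sum>s\<le>k. f s k)"
  unfolding sum.Sigma[OF finite_atLeastAtMost ballI[OF finite_atLeastAtMost]]
    sum.Sigma[OF finite_atMost ballI[OF finite_atMost]]
  by (rule sum.reindex_bij_witness[of _ prod.swap prod.swap]) auto

lemma powi_diff_nat:
  fixes a :: "'a::field"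
  assumes "a \<noteq> 0"
  shows "a powi (int s - int m) = a ^ s / a ^ m"
  using assms by (simp add: power_int_diff)

lemma poly_S_poly_1: "poly (S_poly m) 1 = 0"
proof -
  have "(\<Sum>s=0..m. \<Sum>k=s..m. (of_nat (1 + 2 * k) / of_nat (1 + 2 * s))
        * of_nat ((2 * m + 1) choose (m - k)) * of_nat ((k + s) choose (2 * s))
        * ((-5) powi (int s - int m) / of_nat (lucas (2 * k + 1))))
      = (\<Sum>k\<le>m. of_nat ((2 * m + 1) choose (m - k)) / of_nat (lucas (2 * k + 1)) / (-5) ^ m *
          (\<Sum>s\<le>k. of_nat (1 + 2 * k) / of_nat (1 + 2 * s) * of_nat ((k + s) choose (2 * s))
            * (-5 :: rat) ^ s))"
    unfolding sum_triangle_swap sum_distrib_left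
    by (intro sum.cong refl) (simp add: powi_diff_nat mult_ac del: of_nat_add of_nat_mult of_nat_Suc)
  also have "\<dots> = (\<Sum>k\<le>m. (-1) ^ (m - k) * of_nat ((2 * m + 1) choose (m - k))
        * (of_nat (fib (2 * k + 1)) / of_nat (lucas (2 * k + 1))) * 5 powi (- int m))"
    unfolding sum_ratio_choose_fib
  proof (rule sum.cong)
    fix k assume "k \<in> {..m}"
    \<comment> \<open>The sign of \<open>(-5) ^ m\<close> is what converts (-1)^k into the
      (-1)^(m-k) of the constant term.\<close>
    then have "(-1) ^ k = (-1) ^ (m - k) * ((-1) ^ m :: rat)"
      by (auto simp: le_iff_add power_add)
    then have "(-1) ^ k / (-5) ^ m = (-1) ^ (m - k) * (5 powi (- int m) :: rat)"
      unfolding power_minus[of "5::rat" m] by (simp add: power_int_minus divide_inverse)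
    moreover have "of_nat ((2 * m + 1) choose (m - k)) / of_nat (lucas (2 * k + 1)) / (-5) ^ m *
        ((-1) ^ k * of_nat (fib (2 * k + 1))) =
        (-1) ^ k / (-5) ^ m * of_nat ((2 * m + 1) choose (m - k))
        * (of_nat (fib (2 * k + 1)) / (of_nat (lucas (2 * k + 1)) :: rat))"
      by (simp add: mult_ac del: of_nat_add of_nat_mult of_nat_Suc)
    ultimately show "of_nat ((2 * m + 1) choose (m - k)) / of_nat (lucas (2 * k + 1)) / (-5) ^ m *
        ((-1) ^ k * of_nat (fib (2 * k + 1))) =
        (-1) ^ (m - k) * of_nat ((2 * m + 1) choose (m - k))
        * (of_nat (fib (2 * k + 1)) / of_nat (lucas (2 * k + 1))) * (5 powi (- int m) :: rat)"
      by (simp only: mult_ac)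
  qed simp
  finally show ?thesis
    unfolding S_poly_def poly_diff poly_sum poly_monom power_one mult_1_right
    by (simp add: atMost_atLeast0)
qed

text \<open>Differentiation brings down 2s+1, which cancels the denominator 1+2s, so only the even
  sums remain. For m = 0 the polynomial is x - 1, whose root is simple.\<close>

lemma poly_pderiv_S_poly_1:
  assumes "m \<ge> 1"
  shows "poly (pderiv (S_poly m)) 1 = 0"
proof -
  have "poly (pderiv (S_poly m)) 1 =
      (\<Sum>s=0..m. \<Sum>k=s..m. of_nat (2 * s + 1) * ((of_nat (1 + 2 * k) / of_nat (1 + 2 * s))
        * of_nat ((2 * m + 1) choose (m - k)) * of_nat ((k + s) choose (2 * s))
        * ((-5) powi (int s - int m) / of_nat (lucas (2 * k + 1)))))"
    unfolding S_poly_def pderiv_diff higher_pderiv_sum[where n = 1, simplified] pderiv_monom poly_diff poly_sum poly_monom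
      power_one mult_1_right sum_distrib_left
    by (simp add: pderiv_pCons)
  also have "\<dots> = (\<Sum>k\<le>m. of_nat (2 * k + 1) * of_nat ((2 * m + 1) choose (m - k))
          / of_nat (lucas (2 * k + 1)) / (-5) ^ m *
          (\<Sum>s\<le>k. of_nat ((k + s) choose (2 * s)) * (-5 :: rat) ^ s))"
    unfolding sum_triangle_swap sum_distrib_left
  proof (intro sum.cong refl)
    fix k s
    have "(of_nat (1 + 2 * s) :: rat) \<noteq> 0"
      unfolding of_nat_eq_0_iff by simp
    then show "of_nat (2 * s + 1) * ((of_nat (1 + 2 * k) / of_nat (1 + 2 * s))
        * of_nat ((2 * m + 1) choose (m - k)) * of_nat ((k + s) choose (2 * s))
        * ((-5) powi (int s - int m) / of_nat (lucas (2 * k + 1)))) =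
        of_nat (2 * k + 1) * of_nat ((2 * m + 1) choose (m - k))
          / of_nat (lucas (2 * k + 1)) / (-5) ^ m *
          (of_nat ((k + s) choose (2 * s)) * (-5 :: rat) ^ s)"
      by (simp add: powi_diff_nat mult_ac del: of_nat_add of_nat_mult of_nat_Suc)
  qed
  also have "\<dots> = (\<Sum>k\<le>m. (-1) ^ k * of_nat (2 * k + 1) * of_nat ((2 * m + 1) choose (m - k)))
      / (-5) ^ m"
    unfolding conjunct1[OF sum_choose_lucas_fib] sum_divide_distrib
  proof (intro sum.cong refl)
    fix k
    have "(of_nat (lucas (2 * k + 1)) :: rat) \<noteq> 0"
      using lucas_pos[of "2 * k + 1"] by (simp del: lucas.simps)
    then show "of_nat (2 * k + 1) * of_nat ((2 * m + 1) choose (m - k))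
          / of_nat (lucas (2 * k + 1)) / (-5) ^ m * ((-1) ^ k * of_nat (lucas (2 * k + 1))) =
        (-1) ^ k * of_nat (2 * k + 1) * of_nat ((2 * m + 1) choose (m - k)) / (-5 :: rat) ^ m"
      by (simp del: of_nat_add of_nat_mult of_nat_Suc)
  qed
  also have "\<dots> = 0"
    unfolding alternating_odd_choose_sum[OF assms] by simp
  finally show ?thesis .
qed

lemma square_dvd_of_double_root:
  fixes p :: "'a::idom poly"
  assumes "poly p a = 0" and "poly (pderiv p) a = 0"
  shows "[:-a, 1:]\<^sup>2 dvd p"
proof -
  obtain q where p: "p = [:-a, 1:] * q"
    using assms(1) by (auto simp: poly_eq_0_iff_dvd)
  \<comment> \<open>By the product rule p' = (x - a) q' + q, hence p'(a) = q(a).\<close>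
  have "poly q a = 0"
    using assms(2) unfolding p pderiv_mult by (simp add: pderiv_pCons)
  then have "[:-a, 1:] dvd q"
    by (simp add: poly_eq_0_iff_dvd)
  then show ?thesis
    unfolding p power2_eq_square by (intro mult_dvd_mono dvd_refl)
qed

theorem theorem3p3:
  fixes m :: nat
  assumes "m \<ge> 1"
  shows "[:-1, 1:]\<^sup>2 dvd S_poly m \<and> poly (S_poly m) 1 = 0 \<and> poly (pderiv (S_poly m)) 1 = 0"
  using poly_S_poly_1 poly_pderiv_S_poly_1[OF assms] square_dvd_of_double_root by blast

end
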